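(* Let the hypergraphs $\mathsf H_{20}$, $\mathsf H_{21}$, the complex vectors $\psi^{(20)}_v\in\mathbb C^3$ ($v$ a vertex of $\mathsf H_{20}$), $\psi^{(21)}_v\in\mathbb C^3$ ($v$ a vertex of $\mathsf H_{21}$), and the maps $\Phi_t:\mathbb C^3\to\mathbb R^6$ ($t\in\mathbb R$) be as defined in the context. (i) Define $$t_v^{(20)}=\begin{cases}1,&v\in\{v_{34},v_{45},v_{56}\},\\ 2,&v\in\{v_{67},v_{70}\},\\ 0,&\text{otherwise}.\end{cases}$$ Then $R_v^{(20)}=\Phi_{t_v^{(20)}}(\psi_v^{(20)})$ is a faithful orthogonal representation of $\mathsf H_{20}$ in $\mathbb R^6$. (ii) Define $$t_v^{(21)}=\begin{cases}1,&v=v_{45},\\ 2,&v\in\{v_2,v_3,v_6,v_7,v_{34},v_{56},v_{70}\},\\ 3,&v=v_{67},\\ 0,&\text{otherwise}.\end{cases}$$ Then $R_v^{(21)}=\Phi_{t_v^{(21)}}(\psi_v^{(21)})$ is a faithful orthogonal representation of $\mathsf H_{21}$ in $\mathbb R^6$.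
   Context: Inner product: $\langle x,y\rangle=\sum_{k}\overline{x_k}\,y_k$ (over $\mathbb R$, the standard dot product). Faithful orthogonal representation: let $\mathsf H=(V,\mathcal E)$ be a three-uniform hypergraph, $\mathbb F\in\{\mathbb R,\mathbb C\}$ and $d\ge 3$. A faithful orthogonal representation of $\mathsf H$ in $\mathbb F^d$ assigns to every $v\in V$ a nonzero vector $x_v\in\mathbb F^d$ such that (1) distinct vertices determine distinct rays (one-dimensional subspaces), and (2) for distinct $u,v\in V$, $\langle x_u,x_v\rangle=0$ if and only if $u$ and $v$ belong to a common hyperedge. The maps $\Phi_t$: for $t\in\mathbb R$ and $z=x+\mathrm iy\in\mathbb C^3$ with $x,y\in\mathbb R^3$, $$\Phi_t(x+\mathrm iy)=\frac{(x-ty,\ y+tx)}{\sqrt{1+t^2}}\in\mathbb R^6 .$$ Equivalently $\Phi_t(z)=\Phi_0(\lambda_t z)$ with $\lambda_t=(1+\mathrm it)/\sqrt{1+t^2}$ and $\Phi_0(z)=(\mathrm{Re}\,z_1,\mathrm{Re}\,z_2,\mathrm{Re}\,z_3,\mathrm{Im}\,z_1,\mathrm{Im}\,z_2,\mathrm{Im}\,z_3)$. The hypergraph $\mathsf H_{20}$: it has 20 vertices, namely $v_0,\ldots,v_7$, $v_{01},v_{12},v_{23},v_{34},v_{45},v_{56},v_{67},v_{70}$ (also written $v_{j,j+1}$ with indices modulo $8$), and $a_1,a_2,b_1,b_2$. Its 12 hyperedges are $E_j=\{v_{j-1,j},\,v_j,\,v_{j,j+1}\}$ for $j=0,\ldots,7$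 (indices modulo $8$), and $D_0=\{v_0,a_1,v_4\}$, $D_2=\{v_2,a_2,v_6\}$, $D_1=\{v_1,b_2,v_5\}$, $D_3=\{v_3,b_1,v_7\}$. The hypergraph $\mathsf H_{21}$ is obtained from $\mathsf H_{20}$ by adding one vertex $c$ and the two hyperedges $F_a=\{a_1,c,a_2\}$, $F_b=\{b_1,c,b_2\}$ (21 vertices, 14 hyperedges). The vectors $\psi^{(20)}_v$ (written with the vertex name): set $C=\frac{49-5\sqrt{69}}{26}$, $s=\sqrt C$, $N=1+C$, $r=\sqrt N$, $\eta=\frac{5+12\mathrm i}{13}$, $\zeta=\frac{14+6\sqrt{69}}{65}+\mathrm i\,\frac{4\sqrt{69}-21}{65}$, $(\mu_0,\ldots,\mu_7)=(-1,\eta,1,-\eta,-1,\eta,1,-\eta)$, $(\tau_0,\ldots,\tau_7)=(1,\zeta,-\mathrm i,-\mathrm i\zeta,-1,-\zeta,\mathrm i,\mathrm i\zeta)$. Then $a_1=(s,1,0)$, $a_2=(s,-1,0)$, $b_1=(s,\eta,0)$, $b_2=(s,-\eta,0)$, $v_j=(1,s\mu_j,r\tau_j)$ for $j=0,\ldots,7$, and for $j$ modulo $8$ $$v_{j,j+1}=\overline{v_j\times v_{j+1}}=\bigl(sr(\bar\mu_j\bar\tau_{j+1}-\bar\tau_j\bar\mu_{j+1}),\ r(\bar\tau_j-\bar\tau_{j+1}),\ s(\bar\mu_{j+1}-\bar\mu_j)\bigr).$$ The vectors $\psi^{(21)}_v$ (written with the vertex name): set $p=\frac{\sqrt{14}+\sqrt2}{4}$,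 $q=\frac{\sqrt{14}-\sqrt2}{4}$. Then $c=(0,0,1)$, $a_1=(1,1,0)$, $a_2=(1,-1,0)$, $b_1=(1,\mathrm i,0)$, $b_2=(1,-\mathrm i,0)$, \begin{align*} v_0&=(1,-1,\sqrt2),& v_4&=(1,-1,-\sqrt2),\\ v_1&=(1,\mathrm i,p+\mathrm iq),& v_5&=(1,\mathrm i,-p-\mathrm iq),\\ v_2&=(1,1,-\mathrm i\sqrt2),& v_6&=(1,1,\mathrm i\sqrt2),\\ v_3&=(1,-\mathrm i,q-\mathrm ip),& v_7&=(1,-\mathrm i,-q+\mathrm ip), \end{align*} \begin{align*} v_{01}&=(-p+\mathrm i(q+\sqrt2),\ \sqrt2-p+\mathrm iq,\ 1-\mathrm i),\\ v_{12}&=(\sqrt2-p+\mathrm iq,\ p-\mathrm i(q+\sqrt2),\ 1+\mathrm i),\\ v_{23}&=(q+\sqrt2+\mathrm ip,\ -q+\mathrm i(\sqrt2-p),\ -1+\mathrm i),\\ v_{34}&=(q+\mathrm i(p-\sqrt2),\ q+\sqrt2+\mathrm ip,\ -1-\mathrm i),\\ v_{45}&=(p-\mathrm i(q+\sqrt2),\ -\sqrt2+p-\mathrm iq,\ 1-\mathrm i),\\ v_{56}&=(-\sqrt2+p-\mathrm iq,\ -p+\mathrm i(q+\sqrt2),\ 1+\mathrm i),\\ v_{67}&=(-q-\sqrt2-\mathrm ip,\ q-\mathrm i(\sqrt2-p),\ -1+\mathrm i),\\ v_{70}&=(-q-\mathrm i(p-\sqrt2),\ -q-\sqrt2-\mathrm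 ip,\ -1-\mathrm i). \end{align*} *)

theory Defs
  imports "HOL-Analysis.Analysis"
begin

definition three_uniform_hypergraph :: "'v set \<Rightarrow> 'v set set \<Rightarrow> bool" where
  "three_uniform_hypergraph V E \<longleftrightarrow> (\<forall>e\<in>E. e \<subseteq> V \<and> card e = 3)"

(* The case of the real field; on real vectors the inner product is the standard dot product. *)
definition faithful_orthogonal_rep ::
    "'v set \<Rightarrow> 'v set set \<Rightarrow> ('v \<Rightarrow> real ^ 'd) \<Rightarrow> bool" where
  "faithful_orthogonal_rep V E x \<longleftrightarrow>
     three_uniform_hypergraph V E \<and> CARD('d) \<ge> 3 \<and>
     (\<forall>v\<in>V. x v \<noteq> 0) \<and>
     (\<forall>u\<in>V. \<forall>v\<in>V. u \<noteq> v \<longrightarrow> span {x u} \<noteq> span {x v}) \<and>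
     (\<forall>u\<in>V. \<forall>v\<in>V. u \<noteq> v \<longrightarrow> (x u \<bullet> x v = 0 \<longleftrightarrow> (\<exists>e\<in>E. u \<in> e \<and> v \<in> e)))"

definition Phi :: "real \<Rightarrow> complex ^ 3 \<Rightarrow> real ^ 6" where
  "Phi t z = (1 / sqrt (1 + t\<^sup>2)) *\<^sub>R vector
     [Re (z $ 1) - t * Im (z $ 1), Re (z $ 2) - t * Im (z $ 2), Re (z $ 3) - t * Im (z $ 3),
      Im (z $ 1) + t * Re (z $ 1), Im (z $ 2) + t * Re (z $ 2), Im (z $ 3) + t * Re (z $ 3)]"

(* V j is v_j and VV j is v_{j,j+1}, with j < 8; thus VV 7 is v_{70}, and j - 1 modulo 8 is
   (j + 7) mod 8. *)
datatype vertex = V nat | VV nat | A1 | A2 | B1 | B2 | C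

definition V20 :: "vertex set" where
  "V20 = V ` {..<8} \<union> VV ` {..<8} \<union> {A1, A2, B1, B2}"

definition E20 :: "vertex set set" where
  "E20 = (\<lambda>j. {VV ((j + 7) mod 8), V j, VV j}) ` {..<8} \<union>
     {{V 0, A1, V 4}, {V 2, A2, V 6}, {V 1, B2, V 5}, {V 3, B1, V 7}}"

definition V21 :: "vertex set" where
  "V21 = insert C V20"

definition E21 :: "vertex set set" where
  "E21 = E20 \<union> {{A1, C, A2}, {B1, C, B2}}"

definition cnj_vec :: "complex ^ 'n \<Rightarrow> complex ^ 'n" where
  "cnj_vec x = (\<chi> i. cnj (x $ i))"

(* The library cross product is restricted to real vectors. *)
definition ccross :: "complex ^ 3 \<Rightarrow> complex ^ 3 \<Rightarrow> complex ^ 3" where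
  "ccross x y = vector
     [x $ 2 * y $ 3 - x $ 3 * y $ 2, x $ 3 * y $ 1 - x $ 1 * y $ 3, x $ 1 * y $ 2 - x $ 2 * y $ 1]"

definition C20 :: real where "C20 = (49 - 5 * sqrt 69) / 26"
definition s20 :: real where "s20 = sqrt C20"
definition N20 :: real where "N20 = 1 + C20"
definition r20 :: real where "r20 = sqrt N20"

definition eta :: complex where
  "eta = (5 + 12 * \<i>) / 13"

definition zeta :: complex where
  "zeta = complex_of_real ((14 + 6 * sqrt 69) / 65) +
     \<i> * complex_of_real ((4 * sqrt 69 - 21) / 65)"

definition mu :: "nat \<Rightarrow> complex" where
  "mu j = [-1, eta, 1, -eta, -1, eta, 1, -eta] ! j"

definition tau :: "nat \<Rightarrow> complex" where
  "tau j = [1, zeta, -\<i>, -\<i> * zeta, -1, -zeta, \<i>, \<i> * zeta] ! j"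

definition v20 :: "nat \<Rightarrow> complex ^ 3" where
  "v20 j = vector [1, complex_of_real s20 * mu j, complex_of_real r20 * tau j]"

(* The value at C, which is not a vertex of the 20-vertex hypergraph, is a dummy. *)
primrec psi20 :: "vertex \<Rightarrow> complex ^ 3" where
  "psi20 (V j) = v20 j"
| "psi20 (VV j) = cnj_vec (ccross (v20 j) (v20 ((j + 1) mod 8)))"
| "psi20 A1 = vector [complex_of_real s20, 1, 0]"
| "psi20 A2 = vector [complex_of_real s20, -1, 0]"
| "psi20 B1 = vector [complex_of_real s20, eta, 0]"
| "psi20 B2 = vector [complex_of_real s20, -eta, 0]"
| "psi20 C = 0"

lemma psi20_VV_explicit:
  "psi20 (VV j) = (let k = (j + 1) mod 8; s = complex_of_real s20; r = complex_of_real r20 in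
     vector [s * r * (cnj (mu j) * cnj (tau k) - cnj (tau j) * cnj (mu k)),
             r * (cnj (tau j) - cnj (tau k)),
             s * (cnj (mu k) - cnj (mu j))])"
  by (simp add: Let_def vec_eq_iff forall_3 cnj_vec_def ccross_def v20_def algebra_simps)

definition p21 :: complex where "p21 = complex_of_real ((sqrt 14 + sqrt 2) / 4)"
definition q21 :: complex where "q21 = complex_of_real ((sqrt 14 - sqrt 2) / 4)"
definition w21 :: complex where "w21 = complex_of_real (sqrt 2)"

primrec psi21 :: "vertex \<Rightarrow> complex ^ 3" where
  "psi21 (V j) =
     [vector [1, -1, w21],
      vector [1, \<i>, p21 + \<i> * q21],
      vector [1, 1, -\<i> * w21],
      vector [1, -\<i>, q21 - \<i> * p21],
      vector [1, -1, -w21],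
      vector [1, \<i>, -p21 - \<i> * q21],
      vector [1, 1, \<i> * w21],
      vector [1, -\<i>, -q21 + \<i> * p21]] ! j"
| "psi21 (VV j) =
     [vector [-p21 + \<i> * (q21 + w21), w21 - p21 + \<i> * q21, 1 - \<i>],
      vector [w21 - p21 + \<i> * q21, p21 - \<i> * (q21 + w21), 1 + \<i>],
      vector [q21 + w21 + \<i> * p21, -q21 + \<i> * (w21 - p21), -1 + \<i>],
      vector [q21 + \<i> * (p21 - w21), q21 + w21 + \<i> * p21, -1 - \<i>],
      vector [p21 - \<i> * (q21 + w21), -w21 + p21 - \<i> * q21, 1 - \<i>],
      vector [-w21 + p21 - \<i> * q21, -p21 + \<i> * (q21 + w21), 1 + \<i>],
      vector [-q21 - w21 - \<i> * p21, q21 - \<i> * (w21 - p21), -1 + \<i>],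
      vector [-q21 - \<i> * (p21 - w21), -q21 - w21 - \<i> * p21, -1 - \<i>]] ! j"
| "psi21 A1 = vector [1, 1, 0]"
| "psi21 A2 = vector [1, -1, 0]"
| "psi21 B1 = vector [1, \<i>, 0]"
| "psi21 B2 = vector [1, -\<i>, 0]"
| "psi21 C = vector [0, 0, 1]"

definition t20 :: "vertex \<Rightarrow> real" where
  "t20 v = (if v \<in> {VV 3, VV 4, VV 5} then 1
            else if v \<in> {VV 6, VV 7} then 2
            else 0)"

definition t21 :: "vertex \<Rightarrow> real" where
  "t21 v = (if v = VV 4 then 1
            else if v \<in> {V 2, V 3, V 6, V 7, VV 3, VV 5, VV 7} then 2
            else if v = VV 6 then 3
            else 0)"

end

theory Submission imports Defs begin

text \<open>Up to nonzero real factors, the inner products of the vectors \<open>\<Phi>\<^sub>t \<psi>\<close> lie in the ring of integer combinations of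
  \<open>1\<close> and \<open>sqrt 69\<close>, respectively of \<open>1, sqrt 2, sqrt 7, sqrt 14\<close>. An element of such a ring is nonzero
  once the product of its formal conjugates is a nonzero integer, so all orthogonality relations
  reduce to integer arithmetic. Distinctness of the rays then follows from orthogonality, because
  neither hypergraph contains a triangle of hyperedges.\<close>

section \<open>Orthogonality determines faithfulness\<close>

lemma exhaust_6:
  fixes x :: 6
  shows "x = 1 \<or> x = 2 \<or> x = 3 \<or> x = 4 \<or> x = 5 \<or> x = 6"
proof (induct x)
  case (of_int z)
  \<comment> \<open>The representative \<open>0\<close> is the element \<open>6\<close> of the
    type.\<close>
  then have "z = 0 \<or> z = 1 \<or> z = 2 \<or> z = 3 \<or> z = 4 \<or> z = 5" by fastforce
  then show ?case by auto
qed

lemma sum_6: "sum f (UNIV :: 6 set) = f 1 + f 2 + f 3 + f 4 + f 5 + f 6"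
proof -
  have UNIV_6: "UNIV = {1, 2, 3, 4, 5, 6 :: 6}"
    using exhaust_6 by auto
  show ?thesis
    unfolding UNIV_6 by (simp add: ac_simps)
qed

lemma vector_6:
  "(vector [a, b, c, d, e, f] :: 'a::zero ^ 6) $ 1 = a"
  "(vector [a, b, c, d, e, f] :: 'a::zero ^ 6) $ 2 = b"
  "(vector [a, b, c, d, e, f] :: 'a::zero ^ 6) $ 3 = c"
  "(vector [a, b, c, d, e, f] :: 'a::zero ^ 6) $ 4 = d"
  "(vector [a, b, c, d, e, f] :: 'a::zero ^ 6) $ 5 = e"
  "(vector [a, b, c, d, e, f] :: 'a::zero ^ 6) $ 6 = f"
  unfolding vector_def by simp_all

text \<open>The normalising roots gather in one nonzero denominator, so orthogonality depends only
  on a numerator polynomial in the coordinates and parameters.\<close>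

lemma inner_Phi:
  "Phi t x \<bullet> Phi u y =
     (\<Sum>k\<in>UNIV. (Re (x $ k) - t * Im (x $ k)) * (Re (y $ k) - u * Im (y $ k))
               + (Im (x $ k) + t * Re (x $ k)) * (Im (y $ k) + u * Re (y $ k)))
     / (sqrt (1 + t\<^sup>2) * sqrt (1 + u\<^sup>2))"
  by (simp add: Phi_def inner_vec_def sum_6 sum_3 vector_6 add_divide_distrib)

text \<open>If a vertex outside a hyperedge meets at most one of its three points, orthogonality alone
  separates the rays and excludes zero vectors.\<close>

lemma faithful_orthogonal_repI:
  fixes x :: "'v \<Rightarrow> real ^ 'd"
  assumes "CARD('d) \<ge> 3"
    and uniform: "three_uniform_hypergraph VS E"
    and cover: "\<And>v. v \<in> VS \<Longrightarrow> \<exists>e\<in>E. v \<in> e"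
    and avoid: "\<And>v. v \<in> VS \<Longrightarrow> \<exists>e\<in>E. v \<notin> e"
    and no_triangle: "\<And>e v w w'. \<lbrakk>e \<in> E; v \<in> VS; v \<notin> e; w \<in> e; w' \<in> e; w \<noteq> w'\<rbrakk> \<Longrightarrow>
      \<not> ((\<exists>f\<in>E. v \<in> f \<and> w \<in> f) \<and> (\<exists>f\<in>E. v \<in> f \<and> w' \<in> f))"
    and orth: "\<And>u v. \<lbrakk>u \<in> VS; v \<in> VS; u \<noteq> v\<rbrakk> \<Longrightarrow>
      x u \<bullet> x v = 0 \<longleftrightarrow> (\<exists>e\<in>E. u \<in> e \<and> v \<in> e)"
  shows "faithful_orthogonal_rep VS E x"
proof -
  have edge: "e \<subseteq> VS" "card e = 3" if "e \<in> E" for e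
    using uniform that by (auto simp: three_uniform_hypergraph_def)
  have two_others: "\<exists>w w'. w \<in> e \<and> w' \<in> e \<and> w \<noteq> w' \<and> w \<noteq> u \<and> w' \<noteq> u" if e: "e \<in> E" for e u
  proof -
    obtain a b c where "e = {a, b, c}" "a \<noteq> b" "a \<noteq> c" "b \<noteq> c"
      using edge(2)[OF e] by (auto simp: card_3_iff)
    then show ?thesis by blast
  qed
  \<comment> \<open>Of two points of \<open>e\<close> other than \<open>u\<close>, at most one is
    joined to \<open>v\<close>; the other is not orthogonal to \<open>v\<close>. Avoiding
    \<open>u\<close> makes that point usable against \<open>x u\<close> below.\<close>
  have separate: "\<exists>w\<in>e. w \<noteq> u \<and> x v \<bullet> x w \<noteq> 0" if "e \<in> E" "v \<in> VS" "v \<notin> e" for e u v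
  proof -
    from two_others[OF that(1)] obtain w w'
      where w: "w \<in> e" "w' \<in> e" "w \<noteq> w'" "w \<noteq> u" "w' \<noteq> u"
      by blast
    then have in_VS: "w \<in> VS" "w' \<in> VS" "w \<noteq> v" "w' \<noteq> v"
      using edge(1) that by blast+
    have "x v \<bullet> x w \<noteq> 0 \<or> x v \<bullet> x w' \<noteq> 0"
      using no_triangle[OF that w(1-3)] orth[OF that(2) in_VS(1)] orth[OF that(2) in_VS(2)] in_VS
      by blast
    then show ?thesis
      using w by blast
  qed
  have nonzero: "x v \<noteq> 0" if v: "v \<in> VS" for v
  proof -
    obtain e where "e \<in> E" "v \<notin> e" using avoid[OF v] by blast
    from separate[OF this(1) v this(2)] show ?thesis by auto
  qed
  have rays: "span {x u} \<noteq> span {x v}" if uv: "u \<in> VS" "v \<in> VS" "u \<noteq> v" for u v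
  proof
    assume "span {x u} = span {x v}"
    then have "x v \<in> span {x u}" by (simp add: span_base)
    then obtain c where c: "x v = c *\<^sub>R x u"
      by (auto simp: span_singleton)
    obtain e where e: "e \<in> E" "u \<in> e" using cover uv(1) by blast
    show False
    proof (cases "v \<in> e")
      case True
      then have "x u \<bullet> x v = 0" using orth[OF uv] e by blast
      then show False using c nonzero[OF uv(1)] nonzero[OF uv(2)] by simp
    next
      case False
      from separate[OF e(1) uv(2) False, of u]
      obtain w where w: "w \<in> e" "w \<noteq> u" "x v \<bullet> x w \<noteq> 0"
        by blast
      \<comment> \<open>\<open>w\<close> shares the edge \<open>e\<close> with \<open>u\<close>, so
        \<open>x w\<close> is orthogonal to \<open>x u\<close> and hence to its multiple
        \<open>x v\<close>.\<close>
      have "w \<in> VS" using edge(1)[OF e(1)] w(1) by blast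
      then have "x u \<bullet> x w = 0"
        using orth[OF uv(1), of w] e w by blast
      then show False using w c by simp
    qed
  qed
  show ?thesis
    unfolding faithful_orthogonal_rep_def
    by (intro conjI ballI impI assms(1) uniform nonzero rays orth)
qed

section \<open>Exact arithmetic in biquadratic rings\<close>

text \<open>Coordinates with respect to \<open>1, sqrt m, sqrt n, sqrt m * sqrt n\<close>. Distinct
  tuples may have the same value, for instance when \<open>n = 0\<close>.\<close>

datatype quad = Q int int int int

fun val :: "int \<Rightarrow> int \<Rightarrow> quad \<Rightarrow> real" where
  "val m n (Q a b c d) = a + b * sqrt m + c * sqrt n + d * (sqrt m * sqrt n)"

fun qadd :: "quad \<Rightarrow> quad \<Rightarrow> quad" where
  "qadd (Q a b c d) (Q a' b' c' d') = Q (a + a') (b + b') (c + c') (d + d')"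

fun qscale :: "int \<Rightarrow> quad \<Rightarrow> quad" where
  "qscale k (Q a b c d) = Q (k * a) (k * b) (k * c) (k * d)"

fun qmul :: "int \<Rightarrow> int \<Rightarrow> quad \<Rightarrow> quad \<Rightarrow> quad" where
  "qmul m n (Q a b c d) (Q a' b' c' d') =
     Q (a * a' + m * (b * b') + n * (c * c' + m * (d * d')))
       (a * b' + b * a' + n * (c * d' + d * c'))
       (a * c' + c * a' + m * (b * d' + d * b'))
       (a * d' + d * a' + b * c' + c * b')"

text \<open>\<open>A + B * sqrt m\<close> is the product with the conjugate under
  \<open>sqrt n\<close> to \<open>- sqrt n\<close>; its norm is then taken down to the
  integers.\<close>

fun qnorm :: "int \<Rightarrow> int \<Rightarrow> quad \<Rightarrow> int" where
  "qnorm m n (Q a b c d) =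
     (let A = a * a + m * (b * b) - n * (c * c + m * (d * d)); B = 2 * (a * b - n * (c * d))
      in A * A - m * (B * B))"

lemma val_qadd: "val m n (qadd p q) = val m n p + val m n q"
  by (cases p; cases q) (simp add: algebra_simps)

lemma val_qscale: "val m n (qscale k p) = k * val m n p"
  by (cases p) (simp add: algebra_simps)

lemma val_qmul:
  assumes "0 \<le> m" "0 \<le> n"
  shows "val m n (qmul m n p q) = val m n p * val m n q"
proof -
  \<comment> \<open>Writing the radicands as squares turns the claim into a polynomial
    identity.\<close>
  define x y where "x = sqrt m" and "y = sqrt n"
  have sq: "real_of_int m = x * x" "real_of_int n = y * y"
    using assms by (simp_all add: x_def y_def)
  have val_xy: "val m n (Q a b c d) = a + b * x + c * y + d * (x * y)" for a b c d
    by (simp add: x_def y_def)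
  show ?thesis
    by (cases p; cases q) (simp add: val_xy sq del: val.simps, simp add: algebra_simps)
qed

text \<open>The norm is the product of the conjugates under sign changes of both roots, and the
  value is one of the factors. This is a polynomial identity, so square radicands such as
  \<open>0\<close> are allowed.\<close>

lemma val_nonzero:
  assumes "0 \<le> m" "0 \<le> n" "qnorm m n p \<noteq> 0"
  shows "val m n p \<noteq> 0"
proof
  assume zero: "val m n p = 0"
  obtain a b c d where p: "p = Q a b c d" by (cases p)
  define x y where "x = sqrt m" and "y = sqrt n"
  have sq: "real_of_int m = x * x" "real_of_int n = y * y"
    using assms by (simp_all add: x_def y_def)
  have "of_int (qnorm m n p) =
      (a + b * x + c * y + d * (x * y)) * (a + b * x - c * y - d * (x * y)) *
      (a - b * x + c * y - d * (x * y)) * (a - b * x - c * y + d * (x * y))"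
    by (simp add: p Let_def sq, simp add: algebra_simps)
  also have "\<dots> = 0"
    using zero by (simp add: p x_def y_def)
  finally show False
    using assms(3) by simp
qed

section \<open>Complex numbers with real and imaginary parts in the ring\<close>

type_synonym cquad = "quad \<times> quad"

fun cval :: "int \<Rightarrow> int \<Rightarrow> cquad \<Rightarrow> complex" where
  "cval m n (x, y) = Complex (val m n x) (val m n y)"

fun cadd :: "cquad \<Rightarrow> cquad \<Rightarrow> cquad" where
  "cadd (x, y) (x', y') = (qadd x x', qadd y y')"

fun cscale :: "int \<Rightarrow> cquad \<Rightarrow> cquad" where
  "cscale k (x, y) = (qscale k x, qscale k y)"

fun cmul :: "int \<Rightarrow> int \<Rightarrow> cquad \<Rightarrow> cquad \<Rightarrow> cquad" where
  "cmul m n (x, y) (x', y') =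
     (qadd (qmul m n x x') (qscale (-1) (qmul m n y y')), qadd (qmul m n x y') (qmul m n y x'))"

fun cconj :: "cquad \<Rightarrow> cquad" where
  "cconj (x, y) = (x, qscale (-1) y)"

lemma cval_cadd: "cval m n (cadd z w) = cval m n z + cval m n w"
  by (cases z; cases w) (simp add: complex_eq_iff val_qadd)

lemma cval_cscale: "cval m n (cscale k z) = of_int k * cval m n z"
  by (cases z) (simp add: complex_eq_iff val_qscale)

lemma cval_cmul:
  assumes "0 \<le> m" "0 \<le> n"
  shows "cval m n (cmul m n z w) = cval m n z * cval m n w"
  by (cases z; cases w) (simp add: complex_eq_iff val_qadd val_qscale val_qmul assms)

lemma cval_cconj: "cval m n (cconj z) = cnj (cval m n z)"
  by (cases z) (simp add: complex_eq_iff val_qscale)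

definition ofint :: "int \<Rightarrow> cquad" where
  "ofint k = (Q k 0 0 0, Q 0 0 0 0)"

lemma cval_ofint: "cval m n (ofint k) = of_int k"
  by (simp add: ofint_def complex_eq_iff)

section \<open>Certified orthogonality tables\<close>

text \<open>Multiplication by \<open>1 + i t\<close>, the phase in \<open>Phi\<close> before
  normalisation.\<close>

fun twist :: "int \<Rightarrow> cquad \<Rightarrow> cquad" where
  "twist t (x, y) = (qadd x (qscale (-t) y), qadd y (qscale t x))"

fun qdot :: "int \<Rightarrow> int \<Rightarrow> cquad \<Rightarrow> cquad \<Rightarrow> quad" where
  "qdot m n (x, y) (x', y') = qadd (qmul m n x x') (qmul m n y y')"

lemma val_qdot_twist:
  assumes "0 \<le> m" "0 \<le> n"
  shows "val m n (qdot m n (twist t z) (twist u w)) =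
    (Re (cval m n z) - t * Im (cval m n z)) * (Re (cval m n w) - u * Im (cval m n w))
    + (Im (cval m n z) + t * Re (cval m n z)) * (Im (cval m n w) + u * Re (cval m n w))"
  by (cases z; cases w) (simp add: val_qadd val_qscale val_qmul assms)

type_synonym cvec = "cquad \<times> cquad \<times> cquad"

fun vtwist :: "int \<Rightarrow> cvec \<Rightarrow> cvec" where
  "vtwist t (x, y, z) = (twist t x, twist t y, twist t z)"

fun wform :: "int \<Rightarrow> int \<Rightarrow> quad \<times> quad \<times> quad \<Rightarrow> cvec \<Rightarrow> cvec \<Rightarrow> quad" where
  "wform m n (w1, w2, w3) (x1, x2, x3) (y1, y2, y3) =
     qadd (qmul m n w1 (qdot m n x1 y1))
       (qadd (qmul m n w2 (qdot m n x2 y2)) (qmul m n w3 (qdot m n x3 y3)))"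

definition adj :: "'v list list \<Rightarrow> 'v \<Rightarrow> 'v \<Rightarrow> bool" where
  "adj es u v \<longleftrightarrow> list_ex (\<lambda>e. u \<in> set e \<and> v \<in> set e) es"

text \<open>Each branch is a sufficient certificate: zero coordinates give value zero, a nonzero
  norm gives a nonzero value.\<close>

fun check_pair ::
    "int \<Rightarrow> int \<Rightarrow> quad \<times> quad \<times> quad \<Rightarrow> 'v list list \<Rightarrow> 'v \<times> cvec \<Rightarrow> 'v \<times> cvec \<Rightarrow> bool" where
  "check_pair m n w es (u, x) (v, y) \<longleftrightarrow>
     (if adj es u v then wform m n w x y = Q 0 0 0 0 else qnorm m n (wform m n w x y) \<noteq> 0)"

text \<open>Executable forms of the combinatorial hypotheses of
  \<open>faithful_orthogonal_repI\<close>; the last conjunct excludes triangles.\<close>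

definition check_hypergraph :: "'v list \<Rightarrow> 'v list list \<Rightarrow> bool" where
  "check_hypergraph vs es \<longleftrightarrow>
     list_all (\<lambda>e. distinct e \<and> length e = 3 \<and> list_all (\<lambda>x. x \<in> set vs) e) es \<and>
     list_all (\<lambda>v. list_ex (\<lambda>e. v \<in> set e) es \<and> list_ex (\<lambda>e. v \<notin> set e) es) vs \<and>
     list_all (\<lambda>e. list_all (\<lambda>v. v \<in> set e \<or> length (filter (adj es v) e) \<le> 1) vs) es"

text \<open>The tables test each unordered pair once, in list order; symmetry supplies the reverse
  order.\<close>

lemma sorted_wrt_symmetric:
  assumes "sorted_wrt P xs" "\<And>x y. P x y \<Longrightarrow> P y x" "x \<in> set xs" "y \<in> set xs" "x \<noteq> y"
  shows "P x y"
  using assms by (induction xs) auto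

text \<open>Only the squares of the weights \<open>g\<close> enter the inner products, and these lie in the biquadratic
  ring up to a common factor although the weights do not.\<close>

definition encodes :: "int \<Rightarrow> int \<Rightarrow> real \<times> real \<times> real \<Rightarrow> complex ^ 3 \<Rightarrow> cvec \<Rightarrow> bool" where
  "encodes m n g z x \<longleftrightarrow> (\<exists>k. k \<noteq> 0 \<and>
     z = vector [of_real (k * fst g) * cval m n (fst x),
                 of_real (k * fst (snd g)) * cval m n (fst (snd x)),
                 of_real (k * snd (snd g)) * cval m n (snd (snd x))])"

text \<open>The form and the inner product differ by nonzero real factors: the scalings of the two
  codes, the factor \<open>K\<close> of the weights and the normalising roots.\<close>

lemma inner_Phi_eq_0_iff:
  assumes mn: "0 \<le> m" "0 \<le> n"
    and enc: "encodes m n (g1, g2, g3) z x" "encodes m n (g1, g2, g3) z' y"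
    and w: "K \<noteq> 0" "val m n w1 = K * g1\<^sup>2" "val m n w2 = K * g2\<^sup>2" "val m n w3 = K * g3\<^sup>2"
  shows "Phi (of_int t) z \<bullet> Phi (of_int u) z' = 0 \<longleftrightarrow>
    val m n (wform m n (w1, w2, w3) (vtwist t x) (vtwist u y)) = 0"
proof -
  obtain x1 x2 x3 y1 y2 y3 where xy: "x = (x1, x2, x3)" "y = (y1, y2, y3)"
    by (cases x; cases y) blast
  obtain k where k: "k \<noteq> 0" and z: "z = vector [of_real (k * g1) * cval m n x1,
      of_real (k * g2) * cval m n x2, of_real (k * g3) * cval m n x3]"
    using enc(1) unfolding encodes_def xy fst_conv snd_conv by blast
  obtain l where l: "l \<noteq> 0" and z': "z' = vector [of_real (l * g1) * cval m n y1,
      of_real (l * g2) * cval m n y2, of_real (l * g3) * cval m n y3]"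
    using enc(2) unfolding encodes_def xy fst_conv snd_conv by blast
  let ?f = "\<lambda>a b. (Re a - t * Im a) * (Re b - u * Im b) + (Im a + t * Re a) * (Im b + u * Re b)"
  let ?S = "\<Sum>j\<in>UNIV. ?f (z $ j) (z' $ j)"
  have scale: "?f (of_real (k * g) * a) (of_real (l * g) * b) = k * l * (g\<^sup>2 * ?f a b)" for g a b
    by (simp add: algebra_simps power2_eq_square)
  have "?S = k * l * (g1\<^sup>2 * ?f (cval m n x1) (cval m n y1) + (g2\<^sup>2 * ?f (cval m n x2) (cval m n y2)
      + g3\<^sup>2 * ?f (cval m n x3) (cval m n y3)))"
    unfolding sum_3 z z' vector_3 scale by (simp only: distrib_left add.assoc)
  then have "val m n (wform m n (w1, w2, w3) (vtwist t x) (vtwist u y)) * (k * l) = K * ?S"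
    unfolding xy vtwist.simps wform.simps val_qadd val_qmul[OF mn] val_qdot_twist[OF mn] w
    by (simp only: distrib_left mult_ac)
  moreover have "sqrt (1 + (real_of_int t)\<^sup>2) \<noteq> 0" "sqrt (1 + (real_of_int u)\<^sup>2) \<noteq> 0"
    by (simp_all add: add_nonneg_eq_0_iff)
  then have "Phi (of_int t) z \<bullet> Phi (of_int u) z' = 0 \<longleftrightarrow> ?S = 0"
    unfolding inner_Phi by simp
  moreover have "a = 0 \<longleftrightarrow> b = 0" if "a * (k * l) = K * b" for a b
    using that k l w(1) by auto
  ultimately show ?thesis
    by blast
qed

lemma adj_iff: "adj es u v \<longleftrightarrow> (\<exists>e\<in>set ` set es. u \<in> e \<and> v \<in> e)"
  by (auto simp: adj_def list_ex_iff)

text \<open>Two finite computations suffice: one for the incidence structure, one for the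
  orthogonality of all pairs.\<close>

lemma faithful_orthogonal_rep_certificate:
  fixes psi :: "'v \<Rightarrow> complex ^ 3"
  assumes hyp: "check_hypergraph vs es"
    and pairs: "sorted_wrt (check_pair m n (w1, w2, w3) es)
      (map (\<lambda>v. (v, vtwist (t v) (code v))) vs)"
    and mn: "0 \<le> m" "0 \<le> n"
    and enc: "\<And>v. v \<in> set vs \<Longrightarrow> encodes m n (g1, g2, g3) (psi v) (code v)"
    and w: "K \<noteq> 0" "val m n w1 = K * g1\<^sup>2" "val m n w2 = K * g2\<^sup>2" "val m n w3 = K * g3\<^sup>2"
  shows "faithful_orthogonal_rep (set vs) (set ` set es) (\<lambda>v. Phi (of_int (t v)) (psi v))"
proof (rule faithful_orthogonal_repI)
  define P where "P u v \<longleftrightarrow>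
    (Phi (of_int (t u)) (psi u) \<bullet> Phi (of_int (t v)) (psi v) = 0 \<longleftrightarrow> adj es u v)" for u v
  have P_sym: "P v u" if "P u v" for u v
    using that unfolding P_def adj_iff inner_commute[of "Phi _ (psi v)"] by blast
  have P_pair: "P u v" if "u \<in> set vs" "v \<in> set vs"
    "check_pair m n (w1, w2, w3) es (u, vtwist (t u) (code u)) (v, vtwist (t v) (code v))" for u v
  proof (cases "adj es u v")
    case True
    then show ?thesis
      using that(3) inner_Phi_eq_0_iff[OF mn enc[OF that(1)] enc[OF that(2)] w] by (simp add: P_def)
  next
    case False
    then show ?thesis
      using that(3) inner_Phi_eq_0_iff[OF mn enc[OF that(1)] enc[OF that(2)] w]
        val_nonzero[OF mn] by (simp add: P_def)
  qed
  have "sorted_wrt P vs"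
    by (rule sorted_wrt_mono_rel[OF _ pairs[unfolded sorted_wrt_map]]) (rule P_pair)
  then have "P u v" if "u \<in> set vs" "v \<in> set vs" "u \<noteq> v" for u v
    using P_sym that by (rule sorted_wrt_symmetric)
  then show "Phi (of_int (t u)) (psi u) \<bullet> Phi (of_int (t v)) (psi v) = 0 \<longleftrightarrow>
      (\<exists>e\<in>set ` set es. u \<in> e \<and> v \<in> e)" if "u \<in> set vs" "v \<in> set vs" "u \<noteq> v" for u v
    using that unfolding P_def adj_iff by blast
next
  show "three_uniform_hypergraph (set vs) (set ` set es)"
    using hyp by (force simp: three_uniform_hypergraph_def check_hypergraph_def list_all_iff
      distinct_card)
next
  fix e v w w'
  assume *: "e \<in> set ` set es" "v \<in> set vs" "v \<notin> e" "w \<in> e" "w' \<in> e" "w \<noteq> w'"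
  then obtain l where l: "l \<in> set es" "e = set l" by blast
  then have len: "length (filter (adj es v) l) \<le> 1"
    using hyp * unfolding check_hypergraph_def list_all_iff by blast
  show "\<not> ((\<exists>f\<in>set ` set es. v \<in> f \<and> w \<in> f) \<and> (\<exists>f\<in>set ` set es. v \<in> f \<and> w' \<in> f))"
  proof
    assume "(\<exists>f\<in>set ` set es. v \<in> f \<and> w \<in> f) \<and> (\<exists>f\<in>set ` set es. v \<in> f \<and> w' \<in> f)"
    then have "{w, w'} \<subseteq> set (filter (adj es v) l)"
      using * l by (simp add: adj_iff)
    then have "card {w, w'} \<le> length (filter (adj es v) l)"
      by (meson List.finite_set card_length card_mono le_trans)
    then show False using len * by simp
  qed
qed (use hyp in \<open>auto simp: check_hypergraph_def list_all_iff list_ex_iff\<close>)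

section \<open>The two hypergraphs\<close>

definition edges20 :: "vertex list list" where
  "edges20 = [[V 0, A1, V 4], [V 2, A2, V 6], [V 1, B2, V 5], [V 3, B1, V 7],
     [VV 7, V 0, VV 0], [VV 0, V 1, VV 1], [VV 1, V 2, VV 2], [VV 2, V 3, VV 3],
     [VV 3, V 4, VV 4], [VV 4, V 5, VV 5], [VV 5, V 6, VV 6], [VV 6, V 7, VV 7]]"

definition vertices20 :: "vertex list" where
  "vertices20 = [V 0, V 1, V 2, V 3, V 4, V 5, V 6, V 7,
     VV 0, VV 1, VV 2, VV 3, VV 4, VV 5, VV 6, VV 7, A1, A2, B1, B2]"

lemma lessThan_8: "{..<8::nat} = {0, 1, 2, 3, 4, 5, 6, 7}"
  by auto

lemma V20_eq: "V20 = set vertices20"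
  by (auto simp: V20_def vertices20_def lessThan_8)

lemma E20_eq: "E20 = set ` set edges20"
  unfolding E20_def edges20_def lessThan_8 by simp

lemma V21_eq: "V21 = set (C # vertices20)"
  by (simp add: V21_def V20_eq)

lemma E21_eq: "E21 = set ` set ([A1, C, A2] # [B1, C, B2] # edges20)"
  by (simp add: E21_def E20_eq Un_commute)

text \<open>Integer parameters keep twisting inside the ring. The list lookups are meaningful for
  indices below 8, hence the restriction to vertices in \<open>t20_eq\<close> and
  \<open>t21_eq\<close>.\<close>

fun T20 :: "vertex \<Rightarrow> int" where
  "T20 (VV j) = [0, 0, 0, 1, 1, 1, 2, 2] ! j"
| "T20 _ = 0"

fun T21 :: "vertex \<Rightarrow> int" where
  "T21 (V j) = [0, 0, 2, 2, 0, 0, 2, 2] ! j"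
| "T21 (VV j) = [0, 0, 0, 2, 1, 2, 3, 2] ! j"
| "T21 _ = 0"

lemma t20_eq: "v \<in> V20 \<Longrightarrow> t20 v = T20 v"
  by (auto simp: V20_eq vertices20_def t20_def)

lemma t21_eq: "v \<in> V21 \<Longrightarrow> t21 v = T21 v"
  by (auto simp: V21_eq vertices20_def t21_def)

lemma check_H20: "check_hypergraph vertices20 edges20"
  by code_simp

lemma check_H21: "check_hypergraph (C # vertices20) ([A1, C, A2] # [B1, C, B2] # edges20)"
  by code_simp

section \<open>The 20-vertex hypergraph over the field generated by the square root of 69\<close>

text \<open>The factor 65 clears both the denominator 13 of \<open>eta\<close> and the denominator
  65 of \<open>zeta\<close>; \<open>mu\<close> has period 4.\<close>

definition mu65 :: "nat \<Rightarrow> cquad" where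
  "mu65 j = [(Q (-65) 0 0 0, Q 0 0 0 0), (Q 25 0 0 0, Q 60 0 0 0),
     (Q 65 0 0 0, Q 0 0 0 0), (Q (-25) 0 0 0, Q (-60) 0 0 0)] ! (j mod 4)"

definition tau65 :: "nat \<Rightarrow> cquad" where
  "tau65 j = [(Q 65 0 0 0, Q 0 0 0 0), (Q 14 6 0 0, Q (-21) 4 0 0),
     (Q 0 0 0 0, Q (-65) 0 0 0), (Q (-21) 4 0 0, Q (-14) (-6) 0 0),
     (Q (-65) 0 0 0, Q 0 0 0 0), (Q (-14) (-6) 0 0, Q 21 (-4) 0 0),
     (Q 0 0 0 0, Q 65 0 0 0), (Q 21 (-4) 0 0, Q 14 6 0 0)] ! j"

text \<open>\<open>C20\<close> is a unit with inverse \<open>(49 + 5 sqrt 69) / 26\<close>, and \<open>1 / N20 = (15 + sqrt 69) / 30\<close>.\<close>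

definition invC26 :: cquad where
  "invC26 = (Q 49 5 0 0, Q 0 0 0 0)"

definition invN30 :: cquad where
  "invN30 = (Q 15 1 0 0, Q 0 0 0 0)"

text \<open>With the weights divided out, the three entries carry 1, \<open>1 / C20\<close> and
  \<open>1 / N20\<close>. The factors 6, 15, 13 come from 25350 = 6 * 65 * 65 = 15 * 26 * 65 = 13 *
  30 * 65.\<close>

definition cross20 :: "nat \<Rightarrow> nat \<Rightarrow> cvec" where
  "cross20 j k =
     (cscale 6 (cconj (cadd (cmul 69 0 (mu65 j) (tau65 k))
        (cscale (-1) (cmul 69 0 (tau65 j) (mu65 k))))),
      cmul 69 0 (cscale 15 invC26) (cconj (cadd (tau65 j) (cscale (-1) (tau65 k)))),
      cmul 69 0 (cscale 13 invN30) (cconj (cadd (mu65 k) (cscale (-1) (mu65 j)))))"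

text \<open>The codes of \<open>V j\<close>, \<open>VV j\<close> and the remaining vertices are the vectors scaled by \<open>65\<close>,
  \<open>25350 / (s r)\<close> and \<open>1690 / s\<close>, with the weights \<open>(1, s, r)\<close> divided out. As the second radicand is \<open>0\<close>, the last two
  entries of \<open>Q\<close> are irrelevant.\<close>

fun code20 :: "vertex \<Rightarrow> cvec" where
  "code20 (V j) = (ofint 65, mu65 j, tau65 j)"
| "code20 (VV j) = cross20 j ((j + 1) mod 8)"
| "code20 A1 = (ofint 1690, cmul 69 0 invC26 (mu65 2), ofint 0)"
| "code20 A2 = (ofint 1690, cmul 69 0 invC26 (mu65 0), ofint 0)"
| "code20 B1 = (ofint 1690, cmul 69 0 invC26 (mu65 1), ofint 0)"
| "code20 B2 = (ofint 1690, cmul 69 0 invC26 (mu65 3), ofint 0)"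
| "code20 C = (ofint 0, ofint 0, ofint 0)"

text \<open>The weights are 26 times 1, \<open>C20\<close> and \<open>N20\<close>, the squares of
  the coordinate factors \<open>1, s20, r20\<close>.\<close>

lemma check_pairs_H20:
  "sorted_wrt (check_pair 69 0 (Q 26 0 0 0, Q 49 (-5) 0 0, Q 75 (-5) 0 0) edges20)
     (map (\<lambda>v. (v, vtwist (T20 v) (code20 v))) vertices20)"
  by code_simp

lemma C20_bounds: "0 < C20" "C20 < 1"
proof -
  \<comment> \<open>The bound is chosen so that 5 * 9.8 = 49, the constant term in
    \<open>C20\<close>.\<close>
  have "sqrt 69 < 9.8"
    by (rule real_less_lsqrt) (simp_all add: power2_eq_square)
  moreover have "5 < sqrt 69"
    by (rule real_less_rsqrt) simp
  ultimately show "0 < C20" "C20 < 1"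
    by (auto simp: C20_def)
qed

lemma s20_sq: "s20\<^sup>2 = C20" and s20_nonzero: "s20 \<noteq> 0"
  using C20_bounds by (simp_all add: s20_def)

lemma r20_sq: "r20\<^sup>2 = 1 + C20" and r20_nonzero: "r20 \<noteq> 0"
  using C20_bounds by (simp_all add: r20_def N20_def)

lemma lt_8_iff: "j < 8 \<longleftrightarrow> j \<in> {0, 1, 2, 3, 4, 5, 6, 7 :: nat}"
  using lessThan_8 by blast

lemma cval_mu65: "j < 8 \<Longrightarrow> cval 69 0 (mu65 j) = 65 * mu j"
  unfolding lt_8_iff by (auto simp: mu65_def mu_def eta_def complex_eq_iff)

lemma cval_tau65: "j < 8 \<Longrightarrow> cval 69 0 (tau65 j) = 65 * tau j"
  unfolding lt_8_iff by (auto simp: tau65_def tau_def zeta_def complex_eq_iff field_simps)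

text \<open>The nested product is the shape in which the scale and the weight of a code meet its
  inverse factor.\<close>

lemma cval_invC26: "of_real s20 * (of_real s20 * cval 69 0 invC26) = 26"
proof -
  have "s20\<^sup>2 * (49 + 5 * sqrt 69) = 26"
    by (simp add: s20_sq C20_def field_simps)
  moreover have "cval 69 0 invC26 = of_real (49 + 5 * sqrt 69)"
    by (simp add: invC26_def complex_eq_iff)
  ultimately show ?thesis
    by (metis mult.assoc of_real_mult of_real_numeral power2_eq_square)
qed

lemma cval_invN30: "of_real r20 * (of_real r20 * cval 69 0 invN30) = 30"
proof -
  have "r20\<^sup>2 * (15 + sqrt 69) = 30"
    by (simp add: r20_sq C20_def field_simps)
  moreover have "cval 69 0 invN30 = of_real (15 + sqrt 69)"
    by (simp add: invN30_def complex_eq_iff)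
  ultimately show ?thesis
    by (metis mult.assoc of_real_mult of_real_numeral power2_eq_square)
qed

lemma encodes_V:
  assumes "j < 8"
  shows "encodes 69 0 (1, s20, r20) (psi20 (V j)) (code20 (V j))"
  unfolding encodes_def using assms
  by (intro exI[of _ "1 / 65"]) (simp add: v20_def cval_mu65 cval_tau65 cval_ofint)

lemma encodes_VV:
  assumes j: "j < 8"
  shows "encodes 69 0 (1, s20, r20) (psi20 (VV j)) (code20 (VV j))"
proof -
  define k where "k = (j + 1) mod 8"
  have k: "k < 8" by (simp add: k_def)
  let ?s = "complex_of_real s20" and ?r = "complex_of_real r20"
  \<comment> \<open>The reciprocal of the scale 25350 / (s r) of these codes.\<close>
  let ?c = "s20 * r20 / 25350"
  note cval = cval_cmul[of 69 0] cval_cadd cval_cscale cval_cconj cval_mu65[OF j] cval_mu65[OF k]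
    cval_tau65[OF j] cval_tau65[OF k]
  have 1: "?s * ?r * (cnj (mu j) * cnj (tau k) - cnj (tau j) * cnj (mu k)) =
      of_real ?c * cval 69 0 (fst (cross20 j k))"
    by (simp add: cross20_def cval algebra_simps)
  \<comment> \<open>One \<open>s20\<close> from the scale and one from the weight cancel the inverse
    of \<open>C20\<close>; in the third entry \<open>r20\<close> cancels the inverse of
    \<open>N20\<close> likewise.\<close>
  have 2: "of_real (?c * s20) * cval 69 0 (fst (snd (cross20 j k))) =
      ?r * (?s * (?s * cval 69 0 invC26)) / 26 * (cnj (tau j) - cnj (tau k))"
    by (simp add: cross20_def cval field_simps)
  have 3: "of_real (?c * r20) * cval 69 0 (snd (snd (cross20 j k))) =
      ?s * (?r * (?r * cval 69 0 invN30)) / 30 * (cnj (mu k) - cnj (mu j))"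
    by (simp add: cross20_def cval field_simps)
  have "psi20 (VV j) = vector [of_real (?c * 1) * cval 69 0 (fst (cross20 j k)),
      of_real (?c * s20) * cval 69 0 (fst (snd (cross20 j k))),
      of_real (?c * r20) * cval 69 0 (snd (snd (cross20 j k)))]"
    unfolding psi20_VV_explicit Let_def k_def[symmetric] mult_1_right 1[symmetric] 2 3
      cval_invC26 cval_invN30 by simp
  then show ?thesis
    using s20_nonzero r20_nonzero unfolding encodes_def code20.simps k_def[symmetric] fst_conv snd_conv
    by (intro exI[of _ ?c]) simp
qed

text \<open>The second coordinates of \<open>A1\<close>, \<open>A2\<close>, \<open>B1\<close>,
  \<open>B2\<close> are \<open>mu\<close> at 2, 0, 1, 3, so one argument serves all four. The scale
  is 1690 = 26 * 65, for \<open>invC26\<close> and \<open>mu65\<close>.\<close>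

lemma encodes_diagonal:
  assumes "z = vector [of_real s20, mu j, 0]" "j < 8"
  shows "encodes 69 0 (1, s20, r20) z (ofint 1690, cmul 69 0 invC26 (mu65 j), ofint 0)"
proof -
  have "of_real (s20 / 1690 * s20) * cval 69 0 (cmul 69 0 invC26 (mu65 j)) =
      of_real s20 * (of_real s20 * cval 69 0 invC26) / 26 * mu j"
    by (simp add: cval_cmul cval_mu65 assms(2))
  then have mu: "of_real (s20 / 1690 * s20) * cval 69 0 (cmul 69 0 invC26 (mu65 j)) = mu j"
    unfolding cval_invC26 by simp
  show ?thesis
    using s20_nonzero unfolding encodes_def assms(1) fst_conv snd_conv
    by (intro exI[of _ "s20 / 1690"]) (simp only: mu cval_ofint, simp)
qed

lemma encodes_code20:
  assumes "v \<in> set vertices20"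
  shows "encodes 69 0 (1, s20, r20) (psi20 v) (code20 v)"
proof (cases v)
  case (V j)
  then have "j < 8" using assms by (auto simp: vertices20_def)
  then show ?thesis unfolding V by (rule encodes_V)
next
  case (VV j)
  then have "j < 8" using assms by (auto simp: vertices20_def)
  then show ?thesis unfolding VV by (rule encodes_VV)
qed (use assms in \<open>auto intro!: encodes_diagonal simp: mu_def vertices20_def\<close>)

lemma faithful_H20: "faithful_orthogonal_rep V20 E20 (\<lambda>v. Phi (T20 v) (psi20 v))"
  unfolding V20_eq E20_eq
proof (rule faithful_orthogonal_rep_certificate[OF check_H20 check_pairs_H20 _ _ encodes_code20])
  show "val 69 0 (Q 49 (-5) 0 0) = 26 * s20\<^sup>2" "val 69 0 (Q 75 (-5) 0 0) = 26 * r20\<^sup>2"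
    by (simp_all add: s20_sq r20_sq C20_def)
qed simp_all

section \<open>The 21-vertex hypergraph over the field generated by the square roots of 2 and 7\<close>

text \<open>All vectors are scaled by \<open>4\<close>, which clears the denominators of \<open>p\<close> and \<open>q\<close>.\<close>

fun code21 :: "vertex \<Rightarrow> cvec" where
  "code21 (V j) =
    [((Q 4 0 0 0, Q 0 0 0 0), (Q (-4) 0 0 0, Q 0 0 0 0), (Q 0 4 0 0, Q 0 0 0 0)),
     ((Q 4 0 0 0, Q 0 0 0 0), (Q 0 0 0 0, Q 4 0 0 0), (Q 0 1 0 1, Q 0 (-1) 0 1)),
     ((Q 4 0 0 0, Q 0 0 0 0), (Q 4 0 0 0, Q 0 0 0 0), (Q 0 0 0 0, Q 0 (-4) 0 0)),
     ((Q 4 0 0 0, Q 0 0 0 0), (Q 0 0 0 0, Q (-4) 0 0 0), (Q 0 (-1) 0 1, Q 0 (-1) 0 (-1))),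
     ((Q 4 0 0 0, Q 0 0 0 0), (Q (-4) 0 0 0, Q 0 0 0 0), (Q 0 (-4) 0 0, Q 0 0 0 0)),
     ((Q 4 0 0 0, Q 0 0 0 0), (Q 0 0 0 0, Q 4 0 0 0), (Q 0 (-1) 0 (-1), Q 0 1 0 (-1))),
     ((Q 4 0 0 0, Q 0 0 0 0), (Q 4 0 0 0, Q 0 0 0 0), (Q 0 0 0 0, Q 0 4 0 0)),
     ((Q 4 0 0 0, Q 0 0 0 0), (Q 0 0 0 0, Q (-4) 0 0 0), (Q 0 1 0 (-1), Q 0 1 0 1))] ! j"
| "code21 (VV j) =
    [((Q 0 (-1) 0 (-1), Q 0 3 0 1), (Q 0 3 0 (-1), Q 0 (-1) 0 1), (Q 4 0 0 0, Q (-4) 0 0 0)),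
     ((Q 0 3 0 (-1), Q 0 (-1) 0 1), (Q 0 1 0 1, Q 0 (-3) 0 (-1)), (Q 4 0 0 0, Q 4 0 0 0)),
     ((Q 0 3 0 1, Q 0 1 0 1), (Q 0 1 0 (-1), Q 0 3 0 (-1)), (Q (-4) 0 0 0, Q 4 0 0 0)),
     ((Q 0 (-1) 0 1, Q 0 (-3) 0 1), (Q 0 3 0 1, Q 0 1 0 1), (Q (-4) 0 0 0, Q (-4) 0 0 0)),
     ((Q 0 1 0 1, Q 0 (-3) 0 (-1)), (Q 0 (-3) 0 1, Q 0 1 0 (-1)), (Q 4 0 0 0, Q (-4) 0 0 0)),
     ((Q 0 (-3) 0 1, Q 0 1 0 (-1)), (Q 0 (-1) 0 (-1), Q 0 3 0 1), (Q 4 0 0 0, Q 4 0 0 0)),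
     ((Q 0 (-3) 0 (-1), Q 0 (-1) 0 (-1)), (Q 0 (-1) 0 1, Q 0 (-3) 0 1), (Q (-4) 0 0 0, Q 4 0 0 0)),
     ((Q 0 1 0 (-1), Q 0 3 0 (-1)), (Q 0 (-3) 0 (-1), Q 0 (-1) 0 (-1)), (Q (-4) 0 0 0, Q (-4) 0 0 0))] ! j"
| "code21 A1 = ((Q 4 0 0 0, Q 0 0 0 0), (Q 4 0 0 0, Q 0 0 0 0), (Q 0 0 0 0, Q 0 0 0 0))"
| "code21 A2 = ((Q 4 0 0 0, Q 0 0 0 0), (Q (-4) 0 0 0, Q 0 0 0 0), (Q 0 0 0 0, Q 0 0 0 0))"
| "code21 B1 = ((Q 4 0 0 0, Q 0 0 0 0), (Q 0 0 0 0, Q 4 0 0 0), (Q 0 0 0 0, Q 0 0 0 0))"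
| "code21 B2 = ((Q 4 0 0 0, Q 0 0 0 0), (Q 0 0 0 0, Q (-4) 0 0 0), (Q 0 0 0 0, Q 0 0 0 0))"
| "code21 C = ((Q 0 0 0 0, Q 0 0 0 0), (Q 0 0 0 0, Q 0 0 0 0), (Q 4 0 0 0, Q 0 0 0 0))"

lemma check_pairs_H21:
  "sorted_wrt (check_pair 2 7 (Q 1 0 0 0, Q 1 0 0 0, Q 1 0 0 0)
       ([A1, C, A2] # [B1, C, B2] # edges20))
     (map (\<lambda>v. (v, vtwist (T21 v) (code21 v))) (C # vertices20))"
  by code_simp

lemma encodes_code21:
  assumes "v \<in> set (C # vertices20)"
  shows "encodes 2 7 (1, 1, 1) (psi21 v) (code21 v)"
proof -
  \<comment> \<open>The last basis element of the ring is the product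
    \<open>sqrt 2 * sqrt 7\<close>, while \<open>p21\<close> and \<open>q21\<close> are written with
    \<open>sqrt 14\<close>.\<close>
  have sqrt_14: "sqrt 14 = sqrt 2 * sqrt 7"
    by (simp flip: real_sqrt_mult)
  show ?thesis
    using assms unfolding encodes_def
    by (intro exI[of _ "1 / 4"])
      (auto simp: vertices20_def vec_eq_iff forall_3 complex_eq_iff p21_def q21_def w21_def sqrt_14
        field_simps)
qed

lemma faithful_H21: "faithful_orthogonal_rep V21 E21 (\<lambda>v. Phi (T21 v) (psi21 v))"
  unfolding V21_eq E21_eq
  by (rule faithful_orthogonal_rep_certificate[OF check_H21 check_pairs_H21 _ _ encodes_code21,
    where K = 1]) simp_all

text \<open>Carries the result from the integer parameters to the given ones, whose agreement is
  established on the vertices.\<close>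

lemma faithful_orthogonal_rep_cong:
  assumes "faithful_orthogonal_rep VS E x" "\<And>v. v \<in> VS \<Longrightarrow> x v = y v"
  shows "faithful_orthogonal_rep VS E y"
  using assms unfolding faithful_orthogonal_rep_def by simp

theorem corollary9:
  "faithful_orthogonal_rep V20 E20 (\<lambda>v. Phi (t20 v) (psi20 v)) \<and>
   faithful_orthogonal_rep V21 E21 (\<lambda>v. Phi (t21 v) (psi21 v))"
  using faithful_orthogonal_rep_cong[OF faithful_H20, of "\<lambda>v. Phi (t20 v) (psi20 v)"]
    faithful_orthogonal_rep_cong[OF faithful_H21, of "\<lambda>v. Phi (t21 v) (psi21 v)"]
  by (simp add: t20_eq t21_eq)

end
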